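(* For the v-MP-FQI algorithm (described in the context), with $n$ samples, $p$ features and $q$ test functions, disregarding the complexity of the maximization over $u^+$ for computing $G_{\mathrm{s}}$, the compilation time complexity is of $\mathcal{O}(npq)$, and the per-iteration time complexity is of $\mathcal{O}(pq)$.
   Context: Notation: $\underline{\mathbb{R}}=\mathbb{R}\cup\{-\infty\}$ with the usual conventions; $[1:n]=\{1,\dots,n\}$; $[v]_i$ and $[M]_{i,j}$ denote entries. For $A\in\underline{\mathbb{R}}^{n\times m}$, $B\in\underline{\mathbb{R}}^{m\times p}$, the max-plus product $A\boxtimes B$ has entries $[A\boxtimes B]_{i,j}=\max_{k\in[1:m]}\{[A]_{i,k}+[B]_{k,j}\}$ (vectors are one-column matrices). Setting: $\mathsf{Z}=\mathsf{X}\times\mathsf{U}$ where $\mathsf{X}\subset\mathbb{R}^{d_{\mathrm{x}}}$, $\mathsf{U}\subset\mathbb{R}^{d_{\mathrm{u}}}$ are nonempty state and action spaces; $\gamma\in(0,1)$ is the discount factor. Data: samples $\{z_i=(x_i,u_i),x_i^+,r_i\}_{i\in[1:n]}$ with $z_i\in\mathsf{Z}$, $x_i^+\in\mathsf{X}$, $r_i\in\mathbb{R}$, features $f:\mathsf{Z}\to\underline{\mathbb{R}}^p$, and test functions $h:\mathsf{Z}\to\underline{\mathbb{R}}^q$. The empirical Bellman operator is $\mathbf{B}_{\mathrm{s}}Q(z_i)=r_i+\gamma\max_{u^+\in\mathsf{U}}Q(x_i^+,u^+)$; the maxima over $u^+$ of the features are assumed to exist in $\underline{\mathbb{R}}$.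 v-MP-FQI algorithm. Input: samples, $\gamma$, features $f$, test functions $h$, termination constant $\epsilon>0$. Compilation: compute $F_{\mathrm{s}},G_{\mathrm{s}}\in\underline{\mathbb{R}}^{n\times p}$ and $H_{\mathrm{s}}\in\underline{\mathbb{R}}^{n\times q}$ with entries $[F_{\mathrm{s}}]_{i,j}=[f]_j(z_i)$, $[G_{\mathrm{s}}]_{i,j}=\mathbf{B}_{\mathrm{s}}[f]_j(z_i)$, $[H_{\mathrm{s}}]_{i,k}=[h]_k(z_i)$, and then $F_{\mathrm{s}}^{H}=H_{\mathrm{s}}^\top\boxtimes F_{\mathrm{s}}$, $G_{\mathrm{s}}^{H}=H_{\mathrm{s}}^\top\boxtimes G_{\mathrm{s}}$, both in $\underline{\mathbb{R}}^{q\times p}$. Initialize $\theta\leftarrow(0,\dots,0)^\top\in\mathbb{R}^p$ and $\theta^+\leftarrow\mathbf{D}^H\theta$, where $\mathbf{D}^H\theta=-[(F_{\mathrm{s}}^{H})^{\top}\boxtimes[-(G_{\mathrm{s}}^{H}\boxtimes(\gamma\theta))]]$. Iterations: while $\|\theta^+-\theta\|_\infty\ge\epsilon$, set $\theta\leftarrow\theta^+$ and $\theta^+\leftarrow\mathbf{D}^H\theta$. Output $\theta^+$. Cost model: the time complexity counts elementary operations (additions, multiplications, negations, comparisons/maxima of two numbers), with each evaluation of a feature or test function at a point, and each value $\max_{u^+}[f]_j(x_i^+,u^+)$ (whose maximization cost is disregarded), counted as a unit-cost operation. Max-plus matrix products are computed directly from the definition. *)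

theory Defs
  imports
    "HOL-Analysis.Euclidean_Space"
    "HOL-Library.Extended_Real"
    "HOL-Library.Monad_Syntax"
    "Jordan_Normal_Form.Matrix"
begin

section \<open>Max-plus matrices\<close>

text \<open>
  Entries live in \<^typ>\<open>ereal\<close>: the data are in \<open>\<real> \<union> {-\<infinity>}\<close>, but the negations in the iteration map
  can produce \<open>\<infinity>\<close>. In max-plus algebra \<open>-\<infinity>\<close> is absorbing for addition, also against \<open>\<infinity>\<close>,
  whereas the library addition satisfies \<open>-\<infinity> + \<infinity> = \<infinity>\<close>; hence a separate addition.
\<close>

definition mp_add :: "ereal \<Rightarrow> ereal \<Rightarrow> ereal" (infixl "\<oplus>\<^sub>m\<^sub>p" 65) where
  "a \<oplus>\<^sub>m\<^sub>p b = (if a = -\<infinity> \<or> b = -\<infinity> then -\<infinity> else a + b)"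

definition mp_mult :: "ereal mat \<Rightarrow> ereal mat \<Rightarrow> ereal mat" (infixl "\<boxtimes>" 70) where
  "A \<boxtimes> B = mat (dim_row A) (dim_col B)
     (\<lambda>(i, j). Max ((\<lambda>k. A $$ (i, k) \<oplus>\<^sub>m\<^sub>p B $$ (k, j)) ` {..<dim_col A}))"

definition sup_norm :: "ereal mat \<Rightarrow> ereal" where
  "sup_norm v = Max ((\<lambda>j. \<bar>v $$ (j, 0)\<bar>) ` {..<dim_row v})"


section \<open>Input of the algorithm\<close>

text \<open>Samples, features and test functions are numbered from \<open>0\<close>.\<close>

record ('x, 'u) vmp_input =
  states :: "'x set"
  actions :: "'u set"
  discount :: real
  num_samples :: nat
  num_features :: nat
  num_tests :: nat
  sample :: "nat \<Rightarrow> 'x \<times> 'u"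
  next_state :: "nat \<Rightarrow> 'x"
  reward :: "nat \<Rightarrow> real"
  features :: "'x \<times> 'u \<Rightarrow> ereal vec"
  tests :: "'x \<times> 'u \<Rightarrow> ereal vec"
  tolerance :: real

definition mp_vectors :: "nat \<Rightarrow> ereal vec set" where
  "mp_vectors d = {v \<in> carrier_vec d. \<forall>j<d. v $ j \<noteq> \<infinity>}"

definition valid_input ::
  "('x::euclidean_space, 'u::euclidean_space) vmp_input \<Rightarrow> bool" where
  "valid_input I \<longleftrightarrow>
     states I \<noteq> {} \<and> actions I \<noteq> {} \<and>
     0 < discount I \<and> discount I < 1 \<and>
     1 \<le> num_samples I \<and> 1 \<le> num_features I \<and> 1 \<le> num_tests I \<and>
     (\<forall>i<num_samples I. sample I i \<in> states I \<times> actions I) \<and>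
     (\<forall>i<num_samples I. next_state I i \<in> states I) \<and>
     (\<forall>z \<in> states I \<times> actions I. features I z \<in> mp_vectors (num_features I)) \<and>
     (\<forall>z \<in> states I \<times> actions I. tests I z \<in> mp_vectors (num_tests I)) \<and>
     (\<forall>i<num_samples I. \<forall>j<num_features I. \<exists>u \<in> actions I. \<forall>v \<in> actions I.
        features I (next_state I i, v) $ j \<le> features I (next_state I i, u) $ j) \<and>
     0 < tolerance I"

text \<open>For valid inputs the supremum below is attained, i.e. it is a maximum.\<close>

definition max_feature :: "('x, 'u) vmp_input \<Rightarrow> nat \<Rightarrow> nat \<Rightarrow> ereal" where
  "max_feature I i j = (SUP v \<in> actions I. features I (next_state I i, v) $ j)"


section \<open>Mathematical description of the computed objects\<close>

definition Fs :: "('x, 'u) vmp_input \<Rightarrow> ereal mat" where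
  "Fs I = mat (num_samples I) (num_features I) (\<lambda>(i, j). features I (sample I i) $ j)"

definition Gs :: "('x, 'u) vmp_input \<Rightarrow> ereal mat" where
  "Gs I = mat (num_samples I) (num_features I)
     (\<lambda>(i, j). ereal (reward I i) \<oplus>\<^sub>m\<^sub>p ereal (discount I) * max_feature I i j)"

definition Hs :: "('x, 'u) vmp_input \<Rightarrow> ereal mat" where
  "Hs I = mat (num_samples I) (num_tests I) (\<lambda>(i, k). tests I (sample I i) $ k)"

definition FH :: "('x, 'u) vmp_input \<Rightarrow> ereal mat" where
  "FH I = (Hs I)\<^sup>T \<boxtimes> Fs I"

definition GH :: "('x, 'u) vmp_input \<Rightarrow> ereal mat" where
  "GH I = (Hs I)\<^sup>T \<boxtimes> Gs I"

definition DH :: "('x, 'u) vmp_input \<Rightarrow> ereal mat \<Rightarrow> ereal mat" where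
  "DH I \<theta> = - ((FH I)\<^sup>T \<boxtimes> (- (GH I \<boxtimes> (ereal (discount I) \<cdot>\<^sub>m \<theta>))))"


section \<open>Programs with a count of elementary operations\<close>

text \<open>
  A computation consists of its result and the number of elementary operations used. Only the
  operations of the next block are charged, at unit cost each; reading a stored entry, and thus
  transposition and assignment, is free.
\<close>

datatype 'a tm = TM (val: 'a) (cost: nat)

definition bind_tm :: "'a tm \<Rightarrow> ('a \<Rightarrow> 'b tm) \<Rightarrow> 'b tm" where
  "bind_tm s f = TM (val (f (val s))) (cost s + cost (f (val s)))"

adhoc_overloading Monad_Syntax.bind \<rightleftharpoons> bind_tm

definition return_tm :: "'a \<Rightarrow> 'a tm" where
  "return_tm a = TM a 0"

definition add_op :: "ereal \<Rightarrow> ereal \<Rightarrow> ereal tm" where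
  "add_op a b = TM (a \<oplus>\<^sub>m\<^sub>p b) 1"

definition mult_op :: "ereal \<Rightarrow> ereal \<Rightarrow> ereal tm" where
  "mult_op a b = TM (a * b) 1"

definition neg_op :: "ereal \<Rightarrow> ereal tm" where
  "neg_op a = TM (- a) 1"

definition max_op :: "ereal \<Rightarrow> ereal \<Rightarrow> ereal tm" where
  "max_op a b = TM (max a b) 1"

definition le_op :: "ereal \<Rightarrow> ereal \<Rightarrow> bool tm" where
  "le_op a b = TM (a \<le> b) 1"

text \<open>
  Evaluation of one feature or test function at a point, or of one maximum of a feature over the
  actions.
\<close>

definition eval_op :: "ereal \<Rightarrow> ereal tm" where
  "eval_op a = TM a 1"

text \<open>Fill a matrix by running one program per entry.\<close>

definition mat_tm :: "nat \<Rightarrow> nat \<Rightarrow> (nat \<Rightarrow> nat \<Rightarrow> 'a tm) \<Rightarrow> 'a mat tm" where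
  "mat_tm r c f = TM (mat r c (\<lambda>(i, j). val (f i j))) (\<Sum>i<r. \<Sum>j<c. cost (f i j))"

fun max_tm :: "(nat \<Rightarrow> ereal tm) \<Rightarrow> nat \<Rightarrow> ereal tm" where
  "max_tm f 0 = return_tm (-\<infinity>)"
| "max_tm f (Suc 0) = f 0"
| "max_tm f (Suc (Suc m)) = do {
     a \<leftarrow> max_tm f (Suc m);
     b \<leftarrow> f (Suc m);
     max_op a b
   }"

definition mp_mult_tm :: "ereal mat \<Rightarrow> ereal mat \<Rightarrow> ereal mat tm" where
  "mp_mult_tm A B = mat_tm (dim_row A) (dim_col B)
     (\<lambda>i j. max_tm (\<lambda>k. add_op (A $$ (i, k)) (B $$ (k, j))) (dim_col A))"

definition neg_tm :: "ereal mat \<Rightarrow> ereal mat tm" where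
  "neg_tm A = mat_tm (dim_row A) (dim_col A) (\<lambda>i j. neg_op (A $$ (i, j)))"

definition scale_tm :: "ereal \<Rightarrow> ereal mat \<Rightarrow> ereal mat tm" where
  "scale_tm a A = mat_tm (dim_row A) (dim_col A) (\<lambda>i j. mult_op a (A $$ (i, j)))"

definition abs_tm :: "ereal \<Rightarrow> ereal tm" where
  "abs_tm a = do { b \<leftarrow> neg_op a; max_op a b }"

definition diff_tm :: "ereal mat \<Rightarrow> ereal mat \<Rightarrow> ereal mat tm" where
  "diff_tm A B = mat_tm (dim_row A) (dim_col A)
     (\<lambda>i j. do { b \<leftarrow> neg_op (B $$ (i, j)); add_op (A $$ (i, j)) b })"

definition sup_norm_tm :: "ereal mat \<Rightarrow> ereal tm" where
  "sup_norm_tm v = max_tm (\<lambda>j. abs_tm (v $$ (j, 0))) (dim_row v)"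


section \<open>The v-MP-FQI algorithm\<close>

definition compilation :: "('x, 'u) vmp_input \<Rightarrow> (ereal mat \<times> ereal mat) tm" where
  "compilation I = do {
     F \<leftarrow> mat_tm (num_samples I) (num_features I)
            (\<lambda>i j. eval_op (features I (sample I i) $ j));
     G \<leftarrow> mat_tm (num_samples I) (num_features I)
            (\<lambda>i j. do {
               m \<leftarrow> eval_op (max_feature I i j);
               s \<leftarrow> mult_op (ereal (discount I)) m;
               add_op (ereal (reward I i)) s
             });
     H \<leftarrow> mat_tm (num_samples I) (num_tests I)
            (\<lambda>i k. eval_op (tests I (sample I i) $ k));
     A \<leftarrow> mp_mult_tm H\<^sup>T F;
     B \<leftarrow> mp_mult_tm H\<^sup>T G;
     return_tm (A, B)
   }"

definition DH_tm :: "real \<Rightarrow> ereal mat \<times> ereal mat \<Rightarrow> ereal mat \<Rightarrow> ereal mat tm" where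
  "DH_tm g = (\<lambda>(A, B) \<theta>. do {
     s \<leftarrow> scale_tm (ereal g) \<theta>;
     b \<leftarrow> mp_mult_tm B s;
     c \<leftarrow> neg_tm b;
     d \<leftarrow> mp_mult_tm A\<^sup>T c;
     neg_tm d
   })"

text \<open>
  The state of the loop is \<open>(\<theta>, \<theta>\<^sup>+)\<close>. One pass through the loop consists of the termination test
  followed, if it succeeds, by the update. Once the test fails the algorithm has stopped and the
  state no longer changes.
\<close>

definition initialization :: "('x, 'u) vmp_input \<Rightarrow> (ereal mat \<times> ereal mat) tm" where
  "initialization I = do {
     let \<theta> = mat (num_features I) 1 (\<lambda>_. 0);
     \<theta>' \<leftarrow> DH_tm (discount I) (val (compilation I)) \<theta>;
     return_tm (\<theta>, \<theta>')
   }"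

definition loop_test :: "('x, 'u) vmp_input \<Rightarrow> ereal mat \<times> ereal mat \<Rightarrow> bool tm" where
  "loop_test I = (\<lambda>(\<theta>, \<theta>'). do {
     d \<leftarrow> diff_tm \<theta>' \<theta>;
     e \<leftarrow> sup_norm_tm d;
     le_op (ereal (tolerance I)) e
   })"

definition iteration ::
  "('x, 'u) vmp_input \<Rightarrow> ereal mat \<times> ereal mat \<Rightarrow> (ereal mat \<times> ereal mat) tm" where
  "iteration I = (\<lambda>(\<theta>, \<theta>'). do {
     continue \<leftarrow> loop_test I (\<theta>, \<theta>');
     if continue then do {
       \<theta>'' \<leftarrow> DH_tm (discount I) (val (compilation I)) \<theta>';
       return_tm (\<theta>', \<theta>'')
     } else return_tm (\<theta>, \<theta>')
   })"

fun loop_state :: "('x, 'u) vmp_input \<Rightarrow> nat \<Rightarrow> ereal mat \<times> ereal mat" where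
  "loop_state I 0 = val (initialization I)"
| "loop_state I (Suc k) = val (iteration I (loop_state I k))"

definition compilation_time :: "('x, 'u) vmp_input \<Rightarrow> nat" where
  "compilation_time I = cost (compilation I)"

definition iteration_time :: "('x, 'u) vmp_input \<Rightarrow> nat \<Rightarrow> nat" where
  "iteration_time I k = cost (iteration I (loop_state I k))"


section \<open>The programs compute the described objects\<close>

lemma val_bind_tm [simp]: "val (bind_tm s f) = val (f (val s))"
  by (simp add: bind_tm_def)

lemma val_return_tm [simp]: "val (return_tm a) = a"
  by (simp add: return_tm_def)

lemma val_ops [simp]:
  "val (add_op a b) = a \<oplus>\<^sub>m\<^sub>p b" "val (mult_op a b) = a * b" "val (neg_op a) = - a"
  "val (max_op a b) = max a b" "val (le_op a b) = (a \<le> b)" "val (eval_op a) = a"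
  by (simp_all add: add_op_def mult_op_def neg_op_def max_op_def le_op_def eval_op_def)

lemma val_mat_tm [simp]: "val (mat_tm r c f) = mat r c (\<lambda>(i, j). val (f i j))"
  by (simp add: mat_tm_def)

lemma val_max_tm: "0 < m \<Longrightarrow> val (max_tm f m) = Max ((\<lambda>k. val (f k)) ` {..<m})"
proof (induction f m rule: max_tm.induct)
  case (3 f m)
  have "{..<Suc (Suc m)} = insert (Suc m) {..<Suc m}" by auto
  with 3 show ?case by (simp add: max.commute lessThan_empty_iff)
qed (simp_all add: lessThan_Suc)

lemma val_mp_mult_tm: "0 < dim_col A \<Longrightarrow> val (mp_mult_tm A B) = A \<boxtimes> B"
  by (simp add: mp_mult_tm_def mp_mult_def val_max_tm)

lemma val_neg_tm [simp]: "val (neg_tm A) = - A"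
  by (auto simp: neg_tm_def)

lemma val_scale_tm [simp]: "val (scale_tm a A) = a \<cdot>\<^sub>m A"
  by (auto simp: scale_tm_def)

lemma val_abs_tm [simp]: "val (abs_tm a) = \<bar>a\<bar>"
  by (cases a) (auto simp: abs_tm_def max_def)

lemma val_sup_norm_tm: "0 < dim_row v \<Longrightarrow> val (sup_norm_tm v) = sup_norm v"
  by (simp add: sup_norm_tm_def sup_norm_def val_max_tm)

lemma val_compilation:
  assumes "valid_input I"
  shows "val (compilation I) = (FH I, GH I)"
proof -
  have "0 < num_samples I" using assms by (simp add: valid_input_def)
  then show ?thesis
    by (simp add: compilation_def val_mp_mult_tm FH_def GH_def Fs_def Gs_def Hs_def)
qed

lemma val_DH_tm:
  assumes "valid_input I" and "\<theta> \<in> carrier_mat (num_features I) 1"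
  shows "val (DH_tm (discount I) (val (compilation I)) \<theta>) = DH I \<theta>"
proof -
  have "0 < dim_col (GH I)" "0 < dim_row (FH I)"
    using assms(1) by (simp_all add: valid_input_def FH_def GH_def mp_mult_def Gs_def Hs_def)
  then show ?thesis
    using assms(1) by (simp add: DH_tm_def val_compilation val_mp_mult_tm DH_def)
qed

lemma val_loop_test:
  assumes "valid_input I"
    and "\<theta> \<in> carrier_mat (num_features I) 1" and "\<theta>' \<in> carrier_mat (num_features I) 1"
  shows "val (loop_test I (\<theta>, \<theta>')) \<longleftrightarrow>
    ereal (tolerance I) \<le>
      sup_norm (mat (num_features I) 1 (\<lambda>(i, j). \<theta>' $$ (i, j) \<oplus>\<^sub>m\<^sub>p - \<theta> $$ (i, j)))"
proof -
  have "0 < num_features I" using assms(1) by (simp add: valid_input_def)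
  then show ?thesis
    using assms(2,3) by (simp add: loop_test_def diff_tm_def val_sup_norm_tm)
qed

lemma DH_carrier: "valid_input I \<Longrightarrow> DH I \<theta> \<in> carrier_mat (num_features I) (dim_col \<theta>)"
  by (auto simp: DH_def FH_def mp_mult_def Fs_def)

lemma loop_state_0:
  assumes "valid_input I"
  shows "loop_state I 0 =
    (mat (num_features I) 1 (\<lambda>_. 0), DH I (mat (num_features I) 1 (\<lambda>_. 0)))"
  using assms by (simp add: initialization_def Let_def val_DH_tm)

lemma loop_state_carrier:
  assumes "valid_input I"
  shows "loop_state I k \<in> carrier_mat (num_features I) 1 \<times> carrier_mat (num_features I) 1"
proof (induction k)
  case 0
  show ?case
    using DH_carrier[OF assms, of "mat (num_features I) 1 (\<lambda>_. 0)"]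
    unfolding loop_state_0[OF assms] by simp
next
  case (Suc k)
  obtain \<theta> \<theta>' where s: "loop_state I k = (\<theta>, \<theta>')" by (cases "loop_state I k")
  with Suc have "\<theta> \<in> carrier_mat (num_features I) 1" "\<theta>' \<in> carrier_mat (num_features I) 1" by auto
  then show ?case
    using DH_carrier[OF assms, of \<theta>'] by (simp add: s iteration_def val_DH_tm[OF assms])
qed

lemma loop_state_Suc:
  assumes "valid_input I" and "loop_state I k = (\<theta>, \<theta>')"
  shows "loop_state I (Suc k) =
    (if ereal (tolerance I) \<le>
          sup_norm (mat (num_features I) 1 (\<lambda>(i, j). \<theta>' $$ (i, j) \<oplus>\<^sub>m\<^sub>p - \<theta> $$ (i, j)))
     then (\<theta>', DH I \<theta>') else (\<theta>, \<theta>'))"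
proof -
  have "\<theta> \<in> carrier_mat (num_features I) 1" "\<theta>' \<in> carrier_mat (num_features I) 1"
    using loop_state_carrier[OF assms(1), of k] assms(2) by auto
  then show ?thesis
    using assms by (simp add: iteration_def val_DH_tm val_loop_test)
qed

lemma max_feature_is_max:
  assumes "valid_input I" and "i < num_samples I" and "j < num_features I"
  shows "\<exists>u \<in> actions I. max_feature I i j = features I (next_state I i, u) $ j \<and>
    (\<forall>v \<in> actions I. features I (next_state I i, v) $ j \<le> max_feature I i j)"
proof -
  obtain u where u: "u \<in> actions I"
    and le: "\<forall>v \<in> actions I. features I (next_state I i, v) $ j \<le> features I (next_state I i, u) $ j"
    using assms unfolding valid_input_def by blast
  have "max_feature I i j = features I (next_state I i, u) $ j"
    unfolding max_feature_def using u le by (intro antisym SUP_least SUP_upper) auto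
  with u le show ?thesis by auto
qed

end

theory Submission
  imports Defs
begin

text \<open>
  Write \<open>n\<close>, \<open>p\<close>, \<open>q\<close> for the numbers of samples, features and test functions. A maximum of
  \<open>m\<close> numbers takes \<open>m - 1\<close> comparisons, so an entry of a max-plus product with inner dimension
  \<open>m > 0\<close> takes \<open>2m - 1\<close> operations, and the product of an \<open>r \<times> m\<close> by an \<open>m \<times> c\<close> matrix takes
  \<open>rc(2m - 1)\<close> of them (\<open>cost_mp_mult_tm\<close>). Apart from the outcome of the termination test,
  all costs are therefore determined by the dimensions of the matrices alone.

  Compilation fills \<open>F\<close>, \<open>G\<close>, \<open>H\<close> with \<open>np\<close>, \<open>3np\<close>, \<open>nq\<close> operations and forms two products of
  a \<open>q \<times> n\<close> by an \<open>n \<times> p\<close> matrix, in total \<open>4np + nq + 2pq(2n - 1) \<le> 9npq\<close>. The products are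
  what is expensive, and they are computed only once: a pass through the loop works with the
  \<open>q \<times> p\<close> matrices \<open>FH\<close>, \<open>GH\<close> and with vectors, and \<open>n\<close> no longer occurs. One application of
  the iteration map takes \<open>4pq + p\<close> operations and the termination test \<open>5p\<close>, in total at most
  \<open>4pq + 6p \<le> 10pq\<close>. The last estimates absorb the lower order terms using \<open>p, q \<ge> 1\<close>.
\<close>

lemma cost_bind_tm [simp]: "cost (bind_tm s f) = cost s + cost (f (val s))"
  by (simp add: bind_tm_def)

lemma cost_return_tm [simp]: "cost (return_tm a) = 0"
  by (simp add: return_tm_def)

lemma cost_ops [simp]:
  "cost (add_op a b) = 1" "cost (mult_op a b) = 1" "cost (neg_op a) = 1"
  "cost (max_op a b) = 1" "cost (le_op a b) = 1" "cost (eval_op a) = 1"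
  by (simp_all add: add_op_def mult_op_def neg_op_def max_op_def le_op_def eval_op_def)

lemma cost_mat_tm [simp]: "cost (mat_tm r c f) = (\<Sum>i<r. \<Sum>j<c. cost (f i j))"
  by (simp add: mat_tm_def)

lemma cost_max_tm: "cost (max_tm f m) = (\<Sum>k<m. cost (f k)) + (m - 1)"
  by (induction f m rule: max_tm.induct) simp_all

lemma cost_mp_mult_tm:
  "cost (mp_mult_tm A B) = dim_row A * dim_col B * (2 * dim_col A - 1)"
  by (cases "dim_col A") (simp_all add: mp_mult_tm_def cost_max_tm algebra_simps)

lemma cost_neg_tm: "cost (neg_tm A) = dim_row A * dim_col A"
  by (simp add: neg_tm_def)

lemma cost_scale_tm: "cost (scale_tm a A) = dim_row A * dim_col A"
  by (simp add: scale_tm_def)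

lemma cost_diff_tm: "cost (diff_tm A B) = 2 * dim_row A * dim_col A"
  by (simp add: diff_tm_def)

lemma cost_sup_norm_tm: "cost (sup_norm_tm v) = 2 * dim_row v + (dim_row v - 1)"
  by (simp add: sup_norm_tm_def abs_tm_def cost_max_tm)

lemma compilation_time_eq:
  "compilation_time I =
    4 * num_samples I * num_features I + num_samples I * num_tests I
    + 2 * num_tests I * num_features I * (2 * num_samples I - 1)"
  by (simp add: compilation_time_def compilation_def cost_mp_mult_tm)

lemma compilation_time_le:
  assumes "1 \<le> num_features I" and "1 \<le> num_tests I"
  shows "compilation_time I \<le> 9 * (num_samples I * num_features I * num_tests I)"
proof -
  let ?n = "num_samples I" and ?p = "num_features I" and ?q = "num_tests I"
  have "4 * ?n * ?p \<le> 4 * (?n * ?p * ?q)" "?n * ?q \<le> ?n * ?p * ?q"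
    using assms by simp_all
  moreover have "2 * ?q * ?p * (2 * ?n - 1) \<le> 2 * ?q * ?p * (2 * ?n)"
    by (intro mult_le_mono2) simp
  moreover have "2 * ?q * ?p * (2 * ?n) = 4 * (?n * ?p * ?q)"
    by simp
  ultimately show ?thesis
    unfolding compilation_time_eq by linarith
qed

lemma cost_DH_tm:
  assumes A: "A \<in> carrier_mat q p" and B: "B \<in> carrier_mat q p"
    and \<theta>: "\<theta> \<in> carrier_mat p 1" and pos: "1 \<le> p" "1 \<le> q"
  shows "cost (DH_tm g (A, B) \<theta>) = 4 * (p * q) + p"
proof -
  have dims: "dim_row A = q" "dim_col A = p" "dim_row B = q" "dim_col B = p"
    "dim_row \<theta> = p" "dim_col \<theta> = 1"
    using A B \<theta> by auto
  have "cost (DH_tm g (A, B) \<theta>) = p + (q * (2 * p - 1) + (q + (p * (2 * q - 1) + p)))"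
    using pos by (simp add: DH_tm_def cost_scale_tm cost_mp_mult_tm cost_neg_tm
      val_mp_mult_tm mp_mult_def dims)
  also have "\<dots> = 4 * (p * q) + p"
  proof -
    have "q * (2 * p - 1) + q = 2 * (p * q)" "p * (2 * q - 1) + p = 2 * (p * q)"
      using pos by (simp_all add: diff_mult_distrib2)
    then show ?thesis by simp
  qed
  finally show ?thesis .
qed

lemma cost_loop_test:
  assumes "\<theta>' \<in> carrier_mat p 1" and "1 \<le> p"
  shows "cost (loop_test I (\<theta>, \<theta>')) = 5 * p"
  using assms by (simp add: loop_test_def cost_diff_tm cost_sup_norm_tm diff_tm_def)

lemma compiled_carrier:
  "FH I \<in> carrier_mat (num_tests I) (num_features I)"
  "GH I \<in> carrier_mat (num_tests I) (num_features I)"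
  by (simp_all add: FH_def GH_def mp_mult_def Fs_def Gs_def Hs_def)

text \<open>
  The bound is attained by a pass that performs the update; the final pass, in which the
  termination test fails, costs only \<open>5p\<close>.
\<close>

lemma iteration_time_le:
  assumes "valid_input I"
  shows "iteration_time I k \<le> 4 * (num_features I * num_tests I) + 6 * num_features I"
proof -
  obtain \<theta> \<theta>' where s: "loop_state I k = (\<theta>, \<theta>')" by (cases "loop_state I k")
  then have \<theta>': "\<theta>' \<in> carrier_mat (num_features I) 1"
    using loop_state_carrier[OF assms, of k] by simp
  have pos: "1 \<le> num_features I" "1 \<le> num_tests I"
    using assms by (simp_all add: valid_input_def)
  show ?thesis
    by (simp add: iteration_time_def iteration_def s cost_loop_test[OF \<theta>' pos(1)]
      val_compilation[OF assms] cost_DH_tm[OF compiled_carrier \<theta>' pos])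
qed

theorem theorem4p5:
  shows "(\<exists>C>0. \<forall>I :: ('x::euclidean_space, 'u::euclidean_space) vmp_input.
            valid_input I \<longrightarrow>
            real (compilation_time I)
              \<le> C * real (num_samples I * num_features I * num_tests I))
       \<and> (\<exists>C>0. \<forall>I :: ('x, 'u) vmp_input. \<forall>k.
            valid_input I \<longrightarrow>
            real (iteration_time I k) \<le> C * real (num_features I * num_tests I))"
proof (intro conjI exI allI impI)
  fix I :: "('x, 'u) vmp_input"
  assume "valid_input I"
  then have "compilation_time I \<le> 9 * (num_samples I * num_features I * num_tests I)"
    by (intro compilation_time_le) (simp_all add: valid_input_def)
  then show "real (compilation_time I)
      \<le> 9 * real (num_samples I * num_features I * num_tests I)"
    by linarith
next
  fix I :: "('x, 'u) vmp_input" and k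
  assume I: "valid_input I"
  then have "num_features I \<le> num_features I * num_tests I"
    by (simp add: valid_input_def)
  with iteration_time_le[OF I, of k]
  show "real (iteration_time I k) \<le> 10 * real (num_features I * num_tests I)"
    by linarith
qed simp_all

end
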